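(* For any finite set $X$, let $\divideontimes:\widetilde{\mathbb{D}}_X\otimes\widetilde{\mathbb{D}}_X\to\widetilde{\mathbb{D}}_X$ be the bilinear product defined on basis elements by $$(\mathcal{T}_1,\mathcal{T}_1')\divideontimes(\mathcal{T}_2,\mathcal{T}_2')=\begin{cases}(\mathcal{T}_1,\mathcal{U})&\text{if }\mathcal{T}_2=\mathcal{T}_1/\mathcal{T}_1',\\ 0&\text{otherwise,}\end{cases}$$ where, in the first case, $\mathcal{U}$ is the unique topology on $X$ with $\mathcal{T}_1'\preccurlyeq_{\mathrm{ad}}\mathcal{U}\preccurlyeq_{\mathrm{ad}}\mathcal{T}_1$ and $\mathcal{T}_2'=\mathcal{U}/\mathcal{T}_1'$. Then $\divideontimes$ is associative.
   Context: $\mathbf{k}$ is a field. A topology on a finite set $X$ is identified with its family $\mathcal{T}$ of open subsets. It corresponds bijectively to a quasi-order: $x\le_{\mathcal{T}}y$ iff every open subset containing $x$ contains $y$ (open subsets are the upper ideals). Put $x\sim_{\mathcal{T}}y$ iff $x\le_{\mathcal{T}}y$ and $y\le_{\mathcal{T}}x$. For $Y\subset X$, $\mathcal{T}_{|Y}=\{Z\cap Y:Z\in\mathcal{T}\}$. For topologies on the same set $X$, $\mathcal{T}'$ is finer than $\mathcal{T}$, written $\mathcal{T}'\prec\mathcal{T}$, if every $\mathcal{T}$-open set is $\mathcal{T}'$-open (equality is allowed). If $\mathcal{T}'\prec\mathcal{T}$, the quotient $\mathcal{T}/\mathcal{T}'$ is the topology on $X$ whose quasi-order is the transitive closure of the relation: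 $x\le_{\mathcal{T}}y$ or $y\le_{\mathcal{T}'}x$. The topology $\mathcal{T}'$ is $\mathcal{T}$-admissible, written $\mathcal{T}'\preccurlyeq_{\mathrm{ad}}\mathcal{T}$, if: (i) $\mathcal{T}'\prec\mathcal{T}$; (ii) $\mathcal{T}'_{|Y}=\mathcal{T}_{|Y}$ for every $Y\subset X$ connected for $\mathcal{T}'$; (iii) for all $x,y\in X$, $x\sim_{\mathcal{T}/\mathcal{T}'}y\iff x\sim_{\mathcal{T}'/\mathcal{T}'}y$. $\widetilde{\mathbb{D}}_X$ is the $\mathbf{k}$-vector space with basis the pairs $(\mathcal{T},\mathcal{T}')$ of topologies on $X$ with $\mathcal{T}'\preccurlyeq_{\mathrm{ad}}\mathcal{T}$. Known fact (Fauvet–Foissy–Manchon) making $\mathcal{U}$ well defined: if $\mathcal{T}''\preccurlyeq_{\mathrm{ad}}\mathcal{T}$, then $\mathcal{T}'\mapsto\mathcal{T}'/\mathcal{T}''$ is a bijection from the set of topologies $\mathcal{T}'$ on $X$ with $\mathcal{T}''\preccurlyeq_{\mathrm{ad}}\mathcal{T}'\preccurlyeq_{\mathrm{ad}}\mathcal{T}$ onto the set of topologies $\mathcal{V}$ on $X$ with $\mathcal{V}\preccurlyeq_{\mathrm{ad}}\mathcal{T}/\mathcal{T}''$. *)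

theory Defs
  imports "HOL-Analysis.Analysis" "HOL-Library.Poly_Mapping"
begin

section \<open>Topologies and quasi-orders\<close>

text \<open>A topology on the set \<open>X\<close> is a library topology \<open>T\<close> with \<open>topspace T = X\<close>.
  The order is oriented so that open sets are the upper ideals.\<close>

definition top_le :: "'a topology \<Rightarrow> 'a \<Rightarrow> 'a \<Rightarrow> bool" where
  "top_le T x y \<longleftrightarrow> x \<in> topspace T \<and> y \<in> topspace T \<and> (\<forall>U. openin T U \<and> x \<in> U \<longrightarrow> y \<in> U)"

definition top_equiv :: "'a topology \<Rightarrow> 'a \<Rightarrow> 'a \<Rightarrow> bool" where
  "top_equiv T x y \<longleftrightarrow> top_le T x y \<and> top_le T y x"

definition upper_topology :: "'a set \<Rightarrow> ('a \<Rightarrow> 'a \<Rightarrow> bool) \<Rightarrow> 'a topology" where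
  "upper_topology X r = topology (\<lambda>U. U \<subseteq> X \<and> (\<forall>x\<in>U. \<forall>y\<in>X. r x y \<longrightarrow> y \<in> U))"

lemma openin_upper_topology:
  "openin (upper_topology X r) U \<longleftrightarrow> U \<subseteq> X \<and> (\<forall>x\<in>U. \<forall>y\<in>X. r x y \<longrightarrow> y \<in> U)"
proof -
  have "istopology (\<lambda>U. U \<subseteq> X \<and> (\<forall>x\<in>U. \<forall>y\<in>X. r x y \<longrightarrow> y \<in> U))"
    unfolding istopology_def by blast
  then show ?thesis
    unfolding upper_topology_def by simp
qed

lemma topspace_upper_topology [simp]: "topspace (upper_topology X r) = X"
proof
  show "topspace (upper_topology X r) \<subseteq> X"
    using openin_topspace[of "upper_topology X r"] by (simp only: openin_upper_topology)
  have "openin (upper_topology X r) X"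
    by (simp add: openin_upper_topology)
  then show "X \<subseteq> topspace (upper_topology X r)"
    by (rule openin_subset)
qed

lemma top_le_upper_topology:
  assumes refl: "\<And>x. x \<in> X \<Longrightarrow> r x x"
    and trans: "\<And>x y z. \<lbrakk>x \<in> X; y \<in> X; z \<in> X; r x y; r y z\<rbrakk> \<Longrightarrow> r x z"
  shows "top_le (upper_topology X r) x y \<longleftrightarrow> x \<in> X \<and> y \<in> X \<and> r x y"
proof
  assume le: "top_le (upper_topology X r) x y"
  then have X: "x \<in> X" "y \<in> X"
    by (simp_all add: top_le_def)
  have "openin (upper_topology X r) {z \<in> X. r x z}"
    using X trans unfolding openin_upper_topology by blast
  moreover have "x \<in> {z \<in> X. r x z}"
    using X refl by simp
  ultimately have "y \<in> {z \<in> X. r x z}"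
    using le unfolding top_le_def by blast
  then show "x \<in> X \<and> y \<in> X \<and> r x y"
    using X by simp
next
  assume "x \<in> X \<and> y \<in> X \<and> r x y"
  then show "top_le (upper_topology X r) x y"
    unfolding top_le_def topspace_upper_topology openin_upper_topology by blast
qed

lemma upper_topology_top_le:
  assumes "finite (topspace T)"
  shows "upper_topology (topspace T) (top_le T) = T"
  unfolding topology_eq
proof (intro allI iffI)
  fix U assume U: "openin (upper_topology (topspace T) (top_le T)) U"
  show "openin T U"
  proof (subst openin_subopen, intro ballI)
    fix x assume x: "x \<in> U"
    define N where "N = \<Inter>{V. openin T V \<and> x \<in> V}"
    have xT: "x \<in> topspace T"
      using x U unfolding openin_upper_topology by blast
    have "{V. openin T V \<and> x \<in> V} \<subseteq> Pow (topspace T)"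
      using openin_subset[of T] by blast
    then have "finite {V. openin T V \<and> x \<in> V}"
      by (rule finite_subset) (simp add: assms)
    moreover have "{V. openin T V \<and> x \<in> V} \<noteq> {}"
      using xT openin_topspace[of T] by blast
    ultimately have "openin T N"
      unfolding N_def by (rule openin_Inter) blast
    moreover have "N \<subseteq> U"
    proof
      fix y assume y: "y \<in> N"
      then have *: "y \<in> V" if "openin T V" "x \<in> V" for V
        using that unfolding N_def by blast
      then have "y \<in> topspace T"
        using xT by simp
      with * xT have "top_le T x y"
        unfolding top_le_def by blast
      then show "y \<in> U"
        using x U \<open>y \<in> topspace T\<close> unfolding openin_upper_topology by blast
    qed
    moreover have "x \<in> N"
      by (simp add: N_def)
    ultimately show "\<exists>V. openin T V \<and> x \<in> V \<and> V \<subseteq> U"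
      by blast
  qed
next
  fix U assume U: "openin T U"
  show "openin (upper_topology (topspace T) (top_le T)) U"
    unfolding openin_upper_topology
  proof (intro conjI ballI impI)
    show "U \<subseteq> topspace T"
      using U by (rule openin_subset)
    fix x y assume "x \<in> U" "top_le T x y"
    then show "y \<in> U"
      using U unfolding top_le_def by blast
  qed
qed

definition finer_top :: "'a topology \<Rightarrow> 'a topology \<Rightarrow> bool" where
  "finer_top T' T \<longleftrightarrow> topspace T' = topspace T \<and> (\<forall>U. openin T U \<longrightarrow> openin T' U)"

definition quot_top :: "'a topology \<Rightarrow> 'a topology \<Rightarrow> 'a topology" where
  "quot_top T T' = upper_topology (topspace T) ((\<lambda>x y. top_le T x y \<or> top_le T' y x)\<^sup>+\<^sup>+)"

lemma topspace_quot_top [simp]: "topspace (quot_top T T') = topspace T"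
  by (simp add: quot_top_def)

lemma top_le_quot_top:
  assumes "finer_top T' T"
  shows "top_le (quot_top T T') = (\<lambda>x y. top_le T x y \<or> top_le T' y x)\<^sup>+\<^sup>+"
proof (intro ext)
  fix x y
  define R where "R = (\<lambda>x y. top_le T x y \<or> top_le T' y x)"
  have R: "u \<in> topspace T \<and> v \<in> topspace T" if "R u v" for u v
    using that assms unfolding R_def top_le_def finer_top_def by metis
  have tR: "u \<in> topspace T \<and> v \<in> topspace T" if "R\<^sup>+\<^sup>+ u v" for u v
    using that by induction (auto dest: R)
  have "R\<^sup>+\<^sup>+ u u" if "u \<in> topspace T" for u
    using that by (intro tranclp.r_into_trancl) (simp add: R_def top_le_def)
  then have "top_le (quot_top T T') x y \<longleftrightarrow> x \<in> topspace T \<and> y \<in> topspace T \<and> R\<^sup>+\<^sup>+ x y"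
    unfolding quot_top_def R_def[symmetric]
    by (intro top_le_upper_topology) (auto intro: tranclp_trans)
  then show "top_le (quot_top T T') x y = R\<^sup>+\<^sup>+ x y"
    using tR by blast
qed

definition admissible :: "'a topology \<Rightarrow> 'a topology \<Rightarrow> bool" where
  "admissible T' T \<longleftrightarrow>
     finer_top T' T \<and>
     (\<forall>Y. connectedin T' Y \<longrightarrow> subtopology T' Y = subtopology T Y) \<and>
     (\<forall>x\<in>topspace T. \<forall>y\<in>topspace T.
        top_equiv (quot_top T T') x y \<longleftrightarrow> top_equiv (quot_top T' T') x y)"


section \<open>The vector space of admissible pairs\<close>

definition vec_scale :: "'k::field \<Rightarrow> ('b \<Rightarrow>\<^sub>0 'k) \<Rightarrow> ('b \<Rightarrow>\<^sub>0 'k)" where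
  "vec_scale c = Poly_Mapping.map ((*) c)"

lemma lookup_vec_scale [simp]: "Poly_Mapping.lookup (vec_scale c a) p =
    c * Poly_Mapping.lookup a p"
  by (simp add: vec_scale_def Poly_Mapping.map.rep_eq when_def)

lemma vector_space_vec_scale: "vector_space vec_scale"
  by unfold_locales (auto intro!: poly_mapping_eqI simp: lookup_add algebra_simps)

definition adm_pairs :: "'a set \<Rightarrow> ('a topology \<times> 'a topology) set" where
  "adm_pairs X = {(T, T'). topspace T = X \<and> topspace T' = X \<and> admissible T' T}"

definition adm_space :: "'a set \<Rightarrow> (('a topology \<times> 'a topology) \<Rightarrow>\<^sub>0 'k::field) set" where
  "adm_space X = {a. Poly_Mapping.keys a \<subseteq> adm_pairs X}"

text \<open>The description in the first case picks out exactly one topology whenever both factors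
  are admissible pairs on the same finite set (Fauvet, Foissy, Manchon).\<close>

definition basis_prod ::
  "'a topology \<times> 'a topology \<Rightarrow> 'a topology \<times> 'a topology \<Rightarrow>
     (('a topology \<times> 'a topology) \<Rightarrow>\<^sub>0 'k::field)" where
  "basis_prod p q = (case p of (T1, T1') \<Rightarrow> case q of (T2, T2') \<Rightarrow>
     if T2 = quot_top T1 T1'
     then Poly_Mapping.single
            (T1, THE U. admissible T1' U \<and> admissible U T1 \<and> T2' = quot_top U T1') 1
     else 0)"

definition adm_prod ::
  "(('a topology \<times> 'a topology) \<Rightarrow>\<^sub>0 'k::field) \<Rightarrow> (('a topology \<times> 'a topology) \<Rightarrow>\<^sub>0 'k) \<Rightarrow>
     (('a topology \<times> 'a topology) \<Rightarrow>\<^sub>0 'k)" (infixl \<open>\<divideontimes>\<close> 70) where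
  "a \<divideontimes> b =
     (\<Sum>p\<in>Poly_Mapping.keys a. \<Sum>q\<in>Poly_Mapping.keys b.
        vec_scale (Poly_Mapping.lookup a p * Poly_Mapping.lookup b q) (basis_prod p q))"

lemma vec_scale_0_left [simp]: "vec_scale 0 a = 0"
  by (rule poly_mapping_eqI) simp

lemma adm_prod_superset:
  assumes "finite A" "finite B" "Poly_Mapping.keys a \<subseteq> A" "Poly_Mapping.keys b \<subseteq> B"
  shows "a \<divideontimes> b = (\<Sum>p\<in>A. \<Sum>q\<in>B.
        vec_scale (Poly_Mapping.lookup a p * Poly_Mapping.lookup b q) (basis_prod p q))"
proof -
  have "a \<divideontimes> b = (\<Sum>p\<in>Poly_Mapping.keys a. \<Sum>q\<in>B.
        vec_scale (Poly_Mapping.lookup a p * Poly_Mapping.lookup b q) (basis_prod p q))"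
    unfolding adm_prod_def
    by (rule sum.cong[OF refl], rule sum.mono_neutral_left) (use assms in \<open>auto simp: in_keys_iff\<close>)
  also have "\<dots> = (\<Sum>p\<in>A. \<Sum>q\<in>B.
        vec_scale (Poly_Mapping.lookup a p * Poly_Mapping.lookup b q) (basis_prod p q))"
    by (rule sum.mono_neutral_left) (use assms in \<open>auto simp: in_keys_iff\<close>)
  finally show ?thesis .
qed

lemma adm_prod_single:
  "Poly_Mapping.single p 1 \<divideontimes> Poly_Mapping.single q 1 = basis_prod p q"
proof -
  interpret vector_space vec_scale by (rule vector_space_vec_scale)
  show ?thesis by (simp add: adm_prod_def)
qed

lemma adm_prod_add_left: "(a + a') \<divideontimes> b = a \<divideontimes> b + a' \<divideontimes> b"
proof -
  interpret vector_space vec_scale by (rule vector_space_vec_scale)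
  let ?A = "Poly_Mapping.keys a \<union> Poly_Mapping.keys a'" and ?B = "Poly_Mapping.keys b"
  have "Poly_Mapping.keys (a + a') \<subseteq> ?A"
    by (rule Poly_Mapping.keys_add)
  note * = adm_prod_superset[of ?A ?B "a + a'" b, OF _ _ this]
    adm_prod_superset[of ?A ?B a b] adm_prod_superset[of ?A ?B a' b]
  show ?thesis
    by (simp add: * lookup_add distrib_right scale_left_distrib sum.distrib)
qed

lemma adm_prod_add_right: "a \<divideontimes> (b + b') = a \<divideontimes> b + a \<divideontimes> b'"
proof -
  interpret vector_space vec_scale by (rule vector_space_vec_scale)
  let ?A = "Poly_Mapping.keys a" and ?B = "Poly_Mapping.keys b \<union> Poly_Mapping.keys b'"
  have "Poly_Mapping.keys (b + b') \<subseteq> ?B"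
    by (rule Poly_Mapping.keys_add)
  note * = adm_prod_superset[of ?A ?B a "b + b'", OF _ _ _ this]
    adm_prod_superset[of ?A ?B a b] adm_prod_superset[of ?A ?B a b']
  show ?thesis
    by (simp add: * lookup_add distrib_left scale_left_distrib sum.distrib)
qed

lemma keys_vec_scale: "Poly_Mapping.keys (vec_scale c a) \<subseteq> Poly_Mapping.keys a"
  by (auto simp: in_keys_iff)

lemma adm_prod_scale_left: "vec_scale c a \<divideontimes> b = vec_scale c (a \<divideontimes> b)"
proof -
  interpret vector_space vec_scale by (rule vector_space_vec_scale)
  have "vec_scale c a \<divideontimes> b = (\<Sum>p\<in>Poly_Mapping.keys a. \<Sum>q\<in>Poly_Mapping.keys b.
      vec_scale (c * Poly_Mapping.lookup a p * Poly_Mapping.lookup b q) (basis_prod p q))"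
    using keys_vec_scale[of c a]
    by (simp add: adm_prod_superset[of "Poly_Mapping.keys a" "Poly_Mapping.keys b"])
  then show ?thesis
    by (simp add: adm_prod_def scale_sum_right mult.assoc)
qed

lemma adm_prod_scale_right: "a \<divideontimes> vec_scale c b = vec_scale c (a \<divideontimes> b)"
proof -
  interpret vector_space vec_scale by (rule vector_space_vec_scale)
  have "a \<divideontimes> vec_scale c b = (\<Sum>p\<in>Poly_Mapping.keys a. \<Sum>q\<in>Poly_Mapping.keys b.
      vec_scale (c * (Poly_Mapping.lookup a p * Poly_Mapping.lookup b q)) (basis_prod p q))"
    using keys_vec_scale[of c b]
    by (simp add: adm_prod_superset[of "Poly_Mapping.keys a" "Poly_Mapping.keys b"] mult.left_commute)
  then show ?thesis
    by (simp add: adm_prod_def scale_sum_right)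
qed

end

theory Submission
  imports Defs
begin

text \<open>On a finite set a topology is the same thing as its quasi-order, and a \<open>T\<close>-admissible
  topology is determined by \<open>T\<close> and by its connected components: its quasi-order is that of \<open>T\<close>
  restricted to pairs of points in one component.  Passing from \<open>U\<close> to \<open>U/T'\<close> does not change the
  components, and \<open>(T/T')/(U/T') = T/U\<close>.  The first fact yields the bijection of Fauvet, Foissy and
  Manchon, so that the product is well defined; the second one shows that both bracketings of a
  product of three basis elements are non-zero under the same conditions, and that both
  third topologies solve the same uniquely solvable problem.\<close>

section \<open>Admissibility for relations\<close>

definition quot_rel :: "('a \<Rightarrow> 'a \<Rightarrow> bool) \<Rightarrow> ('a \<Rightarrow> 'a \<Rightarrow> bool) \<Rightarrow> 'a \<Rightarrow> 'a \<Rightarrow> bool" where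
  "quot_rel r s = (\<lambda>x y. r x y \<or> s y x)\<^sup>+\<^sup>+"

text \<open>For the quasi-order of a finite topology, the classes of this relation are the connected
  components.\<close>

abbreviation linked :: "('a \<Rightarrow> 'a \<Rightarrow> bool) \<Rightarrow> 'a \<Rightarrow> 'a \<Rightarrow> bool" where
  "linked r \<equiv> quot_rel r r"

text \<open>The first clause combines (i) and (ii): connected sets are replaced by the largest ones,
  the classes of \<open>linked s\<close>. The second is the forward implication of (iii); the
  reverse one comes from \<open>s \<le> r\<close> by monotonicity and symmetry.\<close>

definition adm_rel :: "('a \<Rightarrow> 'a \<Rightarrow> bool) \<Rightarrow> ('a \<Rightarrow> 'a \<Rightarrow> bool) \<Rightarrow> bool" where
  "adm_rel s r \<longleftrightarrow>
     (\<forall>x y. s x y \<longleftrightarrow> r x y \<and> linked s x y) \<and>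
     (\<forall>x y. quot_rel r s x y \<and> quot_rel r s y x \<longrightarrow> linked s x y)"

section \<open>Quotients as generated transitive relations\<close>

lemma quot_rel_left: "r x y \<Longrightarrow> quot_rel r s x y"
  unfolding quot_rel_def by blast

lemma quot_rel_right: "s y x \<Longrightarrow> quot_rel r s x y"
  unfolding quot_rel_def by blast

lemma quot_rel_trans: "quot_rel r s x y \<Longrightarrow> quot_rel r s y z \<Longrightarrow> quot_rel r s x z"
  unfolding quot_rel_def by (rule tranclp_trans)

lemma quot_rel_least:
  assumes "quot_rel r s x y"
    and "\<And>x y. r x y \<Longrightarrow> t x y" and "\<And>x y. s y x \<Longrightarrow> t x y"
    and "\<And>x y z. t x y \<Longrightarrow> t y z \<Longrightarrow> t x z"
  shows "t x y"
  using assms(1) unfolding quot_rel_def by induction (use assms(2-4) in blast)+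

lemma quot_rel_mono:
  assumes "quot_rel r s x y" and "r \<le> r'" and "s \<le> s'"
  shows "quot_rel r' s' x y"
  using assms(1)
  by (rule quot_rel_least)
    (use assms(2,3) in \<open>auto intro: quot_rel_left quot_rel_right quot_rel_trans\<close>)

lemma linked_sym: "linked r x y \<Longrightarrow> linked r y x"
  by (erule quot_rel_least[of r r x y "\<lambda>x y. linked r y x"])
    (auto intro: quot_rel_left quot_rel_right quot_rel_trans)

section \<open>Admissible relations and their quotients\<close>

lemma adm_rel_le: "adm_rel s r \<Longrightarrow> s \<le> r"
  unfolding adm_rel_def by blast

lemma adm_rel_iff: "adm_rel s r \<Longrightarrow> s x y \<longleftrightarrow> r x y \<and> linked s x y"
  unfolding adm_rel_def by blast

lemma adm_rel_linked: "adm_rel s r \<Longrightarrow> quot_rel r s x y \<Longrightarrow> quot_rel r s y x \<Longrightarrow> linked s x y"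
  unfolding adm_rel_def by blast

lemma adm_rel_between:
  assumes "adm_rel s r" and "s \<le> t" and "t \<le> r"
  shows "adm_rel s t"
  unfolding adm_rel_def
proof (intro conjI allI impI)
  show "s x y \<longleftrightarrow> t x y \<and> linked s x y" for x y
    using adm_rel_iff[OF assms(1), of x y] assms(2,3) by blast
  show "linked s x y" if "quot_rel t s x y \<and> quot_rel t s y x" for x y
    using that adm_rel_linked[OF assms(1)] quot_rel_mono[OF _ assms(3) order_refl] by blast
qed

text \<open>The quotient only adds reversed steps of \<open>s\<close>, and since
  \<open>s \<le> t\<close> these never leave a component of \<open>t\<close>.\<close>

lemma linked_quot_rel:
  assumes "s \<le> t"
  shows "linked (quot_rel t s) = linked t"
proof (intro ext iffI)
  have *: "linked t x y" if "quot_rel t s x y" for x y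
    using that assms by (rule quot_rel_mono[OF _ order_refl])
  show "linked t x y" if "linked (quot_rel t s) x y" for x y
    using that by (rule quot_rel_least) (auto intro: * linked_sym quot_rel_trans)
  show "linked (quot_rel t s) x y" if "linked t x y" for x y
    using that by (rule quot_rel_mono) (auto intro: quot_rel_left)
qed

text \<open>An analogue of the third isomorphism theorem. A step of \<open>t/s\<close> stays in one
  component of \<open>t\<close>, and inside such a component \<open>r/t\<close> moves freely in both
  directions because \<open>t \<le> r\<close>.\<close>

lemma quot_rel_quot_rel:
  assumes "s \<le> t" and "t \<le> r"
  shows "quot_rel (quot_rel r s) (quot_rel t s) = quot_rel r t"
proof (intro ext iffI)
  have *: "quot_rel r t x y" if "quot_rel r s x y" for x y
    using that assms(1) by (rule quot_rel_mono[OF _ order_refl])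
  have **: "quot_rel r t x y" if "quot_rel t s y x" for x y
  proof -
    have "linked t x y"
      using that quot_rel_mono[OF _ order_refl assms(1)] linked_sym by metis
    then show ?thesis
      using assms(2) by (rule quot_rel_mono) simp
  qed
  show "quot_rel r t x y" if "quot_rel (quot_rel r s) (quot_rel t s) x y" for x y
    using that by (rule quot_rel_least) (auto intro: * ** quot_rel_trans)
  show "quot_rel (quot_rel r s) (quot_rel t s) x y" if "quot_rel r t x y" for x y
    using that by (rule quot_rel_mono) (auto intro: quot_rel_left)
qed

text \<open>A path from \<open>x\<close> to \<open>y\<close> in the quotient whose end points are linked closes up to a cycle,
  so admissibility keeps all its points in one class.\<close>

lemma quot_rel_restrict:
  assumes path: "quot_rel r s x y" and "linked e x y"
    and incl: "\<And>x y. quot_rel r s x y \<or> linked e x y \<Longrightarrow> q x y"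
    and trans: "\<And>x y z. q x y \<Longrightarrow> q y z \<Longrightarrow> q x z"
    and sym: "\<And>x y. q x y \<Longrightarrow> q y x \<Longrightarrow> linked e x y"
    and t: "\<And>x y. r x y \<Longrightarrow> linked e x y \<Longrightarrow> t x y"
  shows "quot_rel t s x y"
  using path[unfolded quot_rel_def] \<open>linked e x y\<close>
proof induction
  case (base y)
  then show ?case
    by (metis t quot_rel_left quot_rel_right)
next
  case (step y z)
  have xy: "quot_rel r s x y"
    using step.hyps(1) by (simp add: quot_rel_def)
  have yz: "quot_rel r s y z"
    using step.hyps(2) by (metis quot_rel_left quot_rel_right)
  have zx: "linked e z x"
    using step.prems by (rule linked_sym)
  have exy: "linked e x y"
    \<comment> \<open>The cycle closes through \<open>z\<close>: the last step leads from
      \<open>y\<close> to \<open>z\<close>, and \<open>z\<close> is linked back to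
      \<open>x\<close>.\<close>
    using sym incl trans xy yz zx by metis
  then have "linked e y z"
    using step.prems linked_sym quot_rel_trans by metis
  then have "quot_rel t s y z"
    using step.hyps(2) by (metis t quot_rel_left quot_rel_right)
  with step.IH[OF exy] show ?case
    by (rule quot_rel_trans)
qed

text \<open>Once components and iterated quotient are rewritten, the cycle condition is the one
  already known for \<open>t\<close> in \<open>r\<close>. What remains is that a path of
  \<open>r/s\<close> with both ends in one component of \<open>t\<close> stays there, so that its
  \<open>r\<close>-steps are \<open>t\<close>-steps.\<close>

lemma adm_rel_quot_rel:
  assumes adm: "adm_rel t r" and le: "s \<le> t"
  shows "adm_rel (quot_rel t s) (quot_rel r s)"
  unfolding adm_rel_def linked_quot_rel[OF le] quot_rel_quot_rel[OF le adm_rel_le[OF adm]]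
proof (intro conjI allI impI iffI)
  fix x y
  show "quot_rel r s x y" if "quot_rel t s x y"
    using that adm_rel_le[OF adm] order_refl by (rule quot_rel_mono)
  show "linked t x y" if "quot_rel t s x y"
    using that order_refl le by (rule quot_rel_mono)
  show "quot_rel t s x y" if *: "quot_rel r s x y \<and> linked t x y"
  proof (rule quot_rel_restrict)
    show "quot_rel r s x y" "linked t x y"
      using * by simp_all
    show "quot_rel r t u v" if "quot_rel r s u v \<or> linked t u v" for u v
      using that quot_rel_mono[OF _ order_refl le] quot_rel_mono[OF _ adm_rel_le[OF adm] order_refl]
      by blast
    show "t u v" if "r u v" "linked t u v" for u v
      using that adm_rel_iff[OF adm] by blast
  qed (rule quot_rel_trans adm_rel_linked[OF adm]; assumption)+
next
  show "linked t x y" if "quot_rel r t x y \<and> quot_rel r t y x" for x y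
    using that adm_rel_linked[OF adm] by blast
qed

text \<open>Surjectivity of the Fauvet-Foissy-Manchon map. Quotients keep components, so a preimage
  of \<open>v\<close> must have the components of \<open>v\<close>; this forces \<open>t\<close> to
  be \<open>r\<close> cut along them.\<close>

lemma
  fixes r s v :: "'a \<Rightarrow> 'a \<Rightarrow> bool"
  assumes sr: "adm_rel s r" and v: "adm_rel v (quot_rel r s)"
  defines "t \<equiv> \<lambda>x y. r x y \<and> linked v x y"
  shows adm_rel_lift_le: "s \<le> t"
    and adm_rel_lift_quot: "quot_rel t s = v"
    and adm_rel_lift: "adm_rel t r"
proof -
  let ?q = "quot_rel r s"
  have sq: "?q x y" if "linked s x y" for x y
    using that adm_rel_le[OF sr] order_refl by (rule quot_rel_mono)
  \<comment> \<open>Points linked by \<open>s\<close> lie on a cycle of \<open>r/s\<close>, hence of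
    \<open>(r/s)/v\<close>, and admissibility of \<open>v\<close> links them.\<close>
  have sv: "linked v x y" if "linked s x y" for x y
    using that sq linked_sym quot_rel_left[of ?q _ _ v] adm_rel_linked[OF v] by metis
  have vtrans: "v x z" if "v x y" "v y z" for x y z
    using that adm_rel_iff[OF v] quot_rel_trans by metis
  show le: "s \<le> t"
    using adm_rel_iff[OF sr] sv unfolding t_def by blast
  have tv: "t \<le> v"
    using adm_rel_iff[OF v] quot_rel_left[of r _ _ s] unfolding t_def by blast
  show eq: "quot_rel t s = v"
  proof (intro ext iffI)
    fix x y
    show "v x y" if "quot_rel t s x y"
      using that
    proof (rule quot_rel_least)
      show "v x y" if "s y x" for x y
        using that sq sv adm_rel_iff[OF v] quot_rel_right[of s _ _ s] by metis
    qed (use tv vtrans in blast)+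
    assume vxy: "v x y"
    show "quot_rel t s x y"
    \<comment> \<open>The cycles are closed in \<open>(r/s)/v\<close>, where admissibility of
      \<open>v\<close> controls them.\<close>
    proof (rule quot_rel_restrict)
      show "?q x y" "linked v x y"
        using vxy adm_rel_iff[OF v] by blast+
      show "quot_rel ?q v x y" if "?q x y \<or> linked v x y" for x y
        using that quot_rel_left[of ?q] quot_rel_mono[OF _ adm_rel_le[OF v] order_refl] by blast
      show "t x y" if "r x y" "linked v x y" for x y
        using that by (simp add: t_def)
    qed (rule quot_rel_trans adm_rel_linked[OF v]; assumption)+
  qed
  have link: "linked t = linked v"
    using linked_quot_rel[OF le] eq by simp
  show "adm_rel t r"
    unfolding adm_rel_def link
  proof (intro conjI allI impI)
    show "t x y \<longleftrightarrow> r x y \<and> linked v x y" for x y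
      by (simp add: t_def)
    have "quot_rel ?q v x y" if "quot_rel r t x y" for x y
      using that by (rule quot_rel_mono) (use tv in \<open>auto intro: quot_rel_left\<close>)
    then show "linked v x y" if "quot_rel r t x y \<and> quot_rel r t y x" for x y
      using that adm_rel_linked[OF v] by blast
  qed
qed

text \<open>Injectivity of the same map: the quotient determines the components, and these together
  with \<open>r\<close> determine the relation.\<close>

lemma adm_rel_unique:
  assumes "adm_rel t r" and "adm_rel t' r" and "s \<le> t" and "s \<le> t'"
    and "quot_rel t s = quot_rel t' s"
  shows "t = t'"
proof -
  have "linked t = linked t'"
    using linked_quot_rel[OF assms(3)] linked_quot_rel[OF assms(4)] assms(5) by simp
  then show ?thesis
    by (intro ext) (simp add: adm_rel_iff[OF assms(1)] adm_rel_iff[OF assms(2)])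
qed

section \<open>Admissible topologies\<close>

lemma top_le_topspace: "top_le T x y \<Longrightarrow> x \<in> topspace T \<and> y \<in> topspace T"
  by (simp add: top_le_def)

lemma top_le_refl: "x \<in> topspace T \<Longrightarrow> top_le T x x"
  by (simp add: top_le_def)

lemma top_le_trans: "top_le T x y \<Longrightarrow> top_le T y z \<Longrightarrow> top_le T x z"
  unfolding top_le_def by blast

lemma openin_iff_top_le:
  assumes "finite (topspace T)"
  shows "openin T U \<longleftrightarrow> U \<subseteq> topspace T \<and> (\<forall>x\<in>U. \<forall>y. top_le T x y \<longrightarrow> y \<in> U)"
  using openin_upper_topology[of "topspace T" "top_le T" U] top_le_topspace[of T]
  unfolding upper_topology_top_le[OF assms] by blast

lemma topology_eq_top_le:
  assumes "finite (topspace T)" and "topspace T = topspace T'" and "top_le T = top_le T'"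
  shows "T = T'"
  using assms upper_topology_top_le by metis

lemma finer_top_iff_top_le:
  assumes "finite (topspace T)"
  shows "finer_top T' T \<longleftrightarrow> topspace T' = topspace T \<and> top_le T' \<le> top_le T"
proof
  assume "finer_top T' T"
  then show "topspace T' = topspace T \<and> top_le T' \<le> top_le T"
    unfolding finer_top_def top_le_def by auto
next
  assume *: "topspace T' = topspace T \<and> top_le T' \<le> top_le T"
  then have "finite (topspace T')"
    using assms by simp
  with * assms show "finer_top T' T"
    unfolding finer_top_def by (auto simp: openin_iff_top_le)
qed

lemma top_le_quot_top_rel:
  "finer_top T' T \<Longrightarrow> top_le (quot_top T T') = quot_rel (top_le T) (top_le T')"
  by (simp add: top_le_quot_top quot_rel_def)

lemma finer_top_refl: "finer_top T T"
  by (simp add: finer_top_def)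

section \<open>Connected components of finite spaces\<close>

lemma linked_topspace:
  "linked (top_le T) x y \<Longrightarrow> x \<in> topspace T \<and> y \<in> topspace T"
  by (erule quot_rel_least) (auto simp: top_le_def)

lemma top_equiv_quot_top_self: "top_equiv (quot_top T T) x y \<longleftrightarrow> linked (top_le T) x y"
  unfolding top_equiv_def top_le_quot_top_rel[OF finer_top_refl] using linked_sym by metis

lemma top_le_subtopology:
  assumes "x \<in> Y" and "y \<in> Y"
  shows "top_le (subtopology T Y) x y \<longleftrightarrow> top_le T x y"
  using assms unfolding top_le_def openin_subtopology by auto

text \<open>Open sets are closed upwards. If \<open>A\<close> and \<open>B\<close> separated the
  class, each would also be closed downwards in it, so no chain of comparable points could cross
  from one to the other.\<close>

lemma connectedin_linked:
  assumes "x \<in> topspace T"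
  shows "connectedin T {y. linked (top_le T) x y}" (is "connectedin T ?C")
  unfolding connectedin
proof (intro conjI notI)
  show "?C \<subseteq> topspace T"
    using linked_topspace by fast
  assume "\<exists>A B. openin T A \<and> openin T B \<and> ?C \<subseteq> A \<union> B \<and> A \<inter> B \<inter> ?C = {} \<and> A \<inter> ?C \<noteq> {} \<and> B \<inter> ?C \<noteq> {}"
  then obtain A B where AB: "openin T A" "openin T B" "?C \<subseteq> A \<union> B" "A \<inter> B \<inter> ?C = {}"
    and a: "\<exists>a. a \<in> A \<inter> ?C" and b: "\<exists>b. b \<in> B \<inter> ?C"
    by blast
  have up: "z \<in> V" if "openin T V" "y \<in> V" "top_le T y z" for V y z
    using that unfolding top_le_def by blast
  have step: "y \<in> A \<longleftrightarrow> z \<in> A" if "y \<in> ?C" "z \<in> ?C" "top_le T y z" for y z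
    using that AB up[OF AB(1), of y z] up[OF AB(2), of y z] by blast
  \<comment> \<open>Membership in the class is part of the invariant: this makes it transitive and
    keeps intermediate points of a chain in the class.\<close>
  have edge: "(y \<in> ?C \<longleftrightarrow> z \<in> ?C) \<and> (y \<in> ?C \<longrightarrow> (y \<in> A \<longleftrightarrow> z \<in> A))" if "top_le T y z" for y z
  proof -
    have "y \<in> ?C \<longleftrightarrow> z \<in> ?C"
      using that quot_rel_left[of "top_le T"] quot_rel_right[of "top_le T"]
        quot_rel_trans[of "top_le T" "top_le T" x] by blast
    with step that show ?thesis by blast
  qed
  have "x \<in> A \<longleftrightarrow> z \<in> A" if "z \<in> ?C" for z
  proof -
    let ?t = "\<lambda>y z. (y \<in> ?C \<longleftrightarrow> z \<in> ?C) \<and> (y \<in> ?C \<longrightarrow> (y \<in> A \<longleftrightarrow> z \<in> A))"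
    have "linked (top_le T) x z"
      using that by simp
    then have "?t x z"
    proof (rule quot_rel_least[of _ _ _ _ ?t])
      show "?t y z" if "top_le T y z" for y z
        using that by (rule edge)
      show "?t y z" if "top_le T z y" for y z
        using edge[OF that] by blast
    qed blast
    moreover have "x \<in> ?C"
      using assms top_le_refl quot_rel_left by fastforce
    ultimately show ?thesis by blast
  qed
  then show False
    using a b AB by blast
qed

text \<open>The class of \<open>x\<close> and its complement are both closed upwards, hence open by
  finiteness, and would split \<open>Y\<close>.\<close>

lemma connectedin_imp_linked:
  assumes fin: "finite (topspace T)" and con: "connectedin T Y" and "x \<in> Y" and "y \<in> Y"
  shows "linked (top_le T) x y"
proof (rule ccontr)
  assume *: "\<not> linked (top_le T) x y"
  let ?A = "{z \<in> topspace T. linked (top_le T) x z}"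
  let ?B = "{z \<in> topspace T. \<not> linked (top_le T) x z}"
  have Y: "Y \<subseteq> topspace T"
    using con by (simp add: connectedin)
  have "openin T ?A" "openin T ?B"
    unfolding openin_iff_top_le[OF fin]
    using quot_rel_left[of "top_le T"] quot_rel_right[of "top_le T"]
      quot_rel_trans[of "top_le T" "top_le T"] top_le_topspace[of T] by blast+
  moreover have "x \<in> ?A \<inter> Y" "y \<in> ?B \<inter> Y"
    using * \<open>x \<in> Y\<close> \<open>y \<in> Y\<close> Y quot_rel_left[of "top_le T"] top_le_refl[of x T] by blast+
  moreover have "Y \<subseteq> ?A \<union> ?B" "?A \<inter> ?B \<inter> Y = {}"
    using Y by blast+
  ultimately show False
    using con unfolding connectedin by blast
qed

text \<open>Forwards, (ii) is applied to the component of \<open>x\<close>. Backwards, a connected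
  \<open>Y\<close> lies in a single component, where both orders agree.\<close>

lemma subtopology_connected_iff:
  assumes fin: "finite (topspace T)" and finer: "finer_top T' T"
  shows "(\<forall>Y. connectedin T' Y \<longrightarrow> subtopology T' Y = subtopology T Y) \<longleftrightarrow>
    (\<forall>x y. top_le T' x y \<longleftrightarrow> top_le T x y \<and> linked (top_le T') x y)" (is "?L \<longleftrightarrow> ?R")
proof
  have sp: "topspace T' = topspace T" and le: "top_le T' \<le> top_le T"
    using finer finer_top_iff_top_le[OF fin] by auto
  {
    assume L: ?L
    show ?R
    proof (intro allI iffI conjI)
      fix x y
      show "top_le T x y" if "top_le T' x y"
        using that le by blast
      show "linked (top_le T') x y" if "top_le T' x y"
        using that by (rule quot_rel_left)
      assume *: "top_le T x y \<and> linked (top_le T') x y"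
      let ?C = "{y. linked (top_le T') x y}"
      have x: "x \<in> topspace T'"
        using * linked_topspace by metis
      then have "x \<in> ?C" "y \<in> ?C"
        using * top_le_refl quot_rel_left by fastforce+
      moreover have "subtopology T' ?C = subtopology T ?C"
        using L connectedin_linked[OF x] by blast
      ultimately show "top_le T' x y"
        using * top_le_subtopology by metis
    qed
  next
    assume R: ?R
    show ?L
    proof (intro allI impI)
      fix Y assume Y: "connectedin T' Y"
      show "subtopology T' Y = subtopology T Y"
      proof (rule topology_eq_top_le)
        show "finite (topspace (subtopology T' Y))"
          using fin sp by simp
        show "topspace (subtopology T' Y) = topspace (subtopology T Y)"
          using sp by simp
        show "top_le (subtopology T' Y) = top_le (subtopology T Y)"
        proof (intro ext)
          fix x y
          show "top_le (subtopology T' Y) x y = top_le (subtopology T Y) x y"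
          proof (cases "x \<in> Y \<and> y \<in> Y")
            case True
            then have "linked (top_le T') x y"
              using connectedin_imp_linked[OF _ Y] fin sp by simp
            with True R show ?thesis
              by (simp add: top_le_subtopology)
          next
            case False
            then show ?thesis
              by (auto simp: top_le_def)
          qed
        qed
      qed
    qed
  }
qed

text \<open>The case split is there because the formula for the order of a quotient presupposes
  \<open>finer_top\<close>; when this fails, both sides are false.\<close>

lemma admissible_iff_adm_rel:
  assumes fin: "finite (topspace T)"
  shows "admissible T' T \<longleftrightarrow> topspace T' = topspace T \<and> adm_rel (top_le T') (top_le T)"
proof (cases "finer_top T' T")
  case False
  then show ?thesis
    using finer_top_iff_top_le[OF fin] adm_rel_le unfolding admissible_def by blast
next
  case True
  have sp: "topspace T' = topspace T" and le: "top_le T' \<le> top_le T"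
    using True finer_top_iff_top_le[OF fin] by auto
  let ?q = "quot_rel (top_le T) (top_le T')"
  have *: "?q x y" if "linked (top_le T') x y" for x y
    using that le order_refl by (rule quot_rel_mono)
  \<comment> \<open>Both relations live on \<open>topspace T\<close>, so bounded and unbounded
    quantifiers agree.\<close>
  have "(\<forall>x\<in>topspace T. \<forall>y\<in>topspace T.
      top_equiv (quot_top T T') x y \<longleftrightarrow> top_equiv (quot_top T' T') x y) \<longleftrightarrow>
    (\<forall>x y. ?q x y \<and> ?q y x \<longrightarrow> linked (top_le T') x y)"
    unfolding top_equiv_quot_top_self
    unfolding top_equiv_def top_le_quot_top_rel[OF True]
    using * linked_sym top_le_topspace[of "quot_top T T'"]
    unfolding top_le_quot_top_rel[OF True] topspace_quot_top by metis
  then show ?thesis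
    unfolding admissible_def adm_rel_def subtopology_connected_iff[OF fin True]
    using True sp by simp
qed

section \<open>Quotients of admissible topologies\<close>

lemma admissible_finer: "admissible T' T \<Longrightarrow> finer_top T' T"
  by (simp add: admissible_def)

lemma admissible_topspace: "admissible T' T \<Longrightarrow> topspace T' = topspace T"
  by (simp add: admissible_def finer_top_def)

lemma finer_top_trans: "finer_top T'' T' \<Longrightarrow> finer_top T' T \<Longrightarrow> finer_top T'' T"
  by (simp add: finer_top_def)

lemma admissible_between:
  assumes "finite (topspace T)" and "admissible T'' T" and "finer_top T'' T'" and "finer_top T' T"
  shows "admissible T'' T'"
  using assms adm_rel_between by (metis admissible_iff_adm_rel finer_top_iff_top_le)

lemma quot_top_quot_top:
  assumes fin: "finite (topspace T)" and "finer_top T'' T'" and "finer_top T' T"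
  shows "quot_top (quot_top T T'') (quot_top T' T'') = quot_top T T'"
proof (rule topology_eq_top_le)
  have sp: "topspace T' = topspace T" and le: "top_le T' \<le> top_le T" "top_le T'' \<le> top_le T'"
    using assms finer_top_iff_top_le by metis+
  have q: "top_le (quot_top T T'') = quot_rel (top_le T) (top_le T'')"
    "top_le (quot_top T' T'') = quot_rel (top_le T') (top_le T'')"
    using assms by (auto intro: top_le_quot_top_rel finer_top_trans)
  \<comment> \<open>This licenses the order formula for the outer quotient.\<close>
  have "finer_top (quot_top T' T'') (quot_top T T'')"
    using fin sp le quot_rel_mono[OF _ le(1) order_refl]
    by (auto simp: finer_top_iff_top_le q)
  then show "top_le (quot_top (quot_top T T'') (quot_top T' T'')) = top_le (quot_top T T')"
    using assms(3) le by (simp add: top_le_quot_top_rel q quot_rel_quot_rel)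
qed (use fin in simp_all)

lemma admissible_quot_top:
  assumes fin: "finite (topspace T)" and "finer_top T'' T'" and "admissible T' T"
  shows "admissible (quot_top T' T'') (quot_top T T'')"
proof -
  have sp: "topspace T' = topspace T"
    using assms(3) by (rule admissible_topspace)
  have "finer_top T'' T"
    using assms(2,3) admissible_finer finer_top_trans by blast
  moreover have "top_le T'' \<le> top_le T'"
    using assms(2) fin sp by (simp add: finer_top_iff_top_le)
  ultimately show ?thesis
    using assms fin sp adm_rel_quot_rel
    by (auto simp: admissible_iff_adm_rel top_le_quot_top_rel)
qed

text \<open>The Fauvet-Foissy-Manchon bijection, one fibre at a time: existence from
  \<open>adm_rel_lift\<close>, uniqueness from \<open>adm_rel_unique\<close>.\<close>

lemma ex1_admissible_quot_top:
  assumes fin: "finite (topspace T)" and adm: "admissible T'' T"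
    and V: "admissible V (quot_top T T'')"
  shows "\<exists>!U. admissible T'' U \<and> admissible U T \<and> V = quot_top U T''"
proof (rule ex_ex1I)
  have sp: "topspace T'' = topspace T" and sr: "adm_rel (top_le T'') (top_le T)"
    using adm admissible_iff_adm_rel[OF fin] by auto
  have spV: "topspace V = topspace T"
    and v: "adm_rel (top_le V) (quot_rel (top_le T) (top_le T''))"
    using V fin top_le_quot_top_rel[OF admissible_finer[OF adm]]
    by (auto simp: admissible_iff_adm_rel)
  define t where "t = (\<lambda>x y. top_le T x y \<and> linked (top_le V) x y)"
  note lift = adm_rel_lift_le[OF sr v, folded t_def] adm_rel_lift_quot[OF sr v, folded t_def]
    adm_rel_lift[OF sr v, folded t_def]
  define U where "U = upper_topology (topspace T) t"
  have spU: "topspace U = topspace T"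
    by (simp add: U_def)
  \<comment> \<open>A quasi-order on the space is recovered from its topology of upper
    ideals.\<close>
  have leU: "top_le U = t"
  proof (intro ext)
    fix x y
    have "top_le U x y \<longleftrightarrow> x \<in> topspace T \<and> y \<in> topspace T \<and> t x y"
      unfolding U_def
    proof (rule top_le_upper_topology)
      show "t x x" if "x \<in> topspace T" for x
        using that spV unfolding t_def by (auto intro: top_le_refl quot_rel_left)
      show "t x z" if "t x y" "t y z" for x y z
        using that unfolding t_def by (blast intro: top_le_trans quot_rel_trans)
    qed
    then show "top_le U x y = t x y"
      unfolding t_def using top_le_topspace by metis
  qed
  have UT: "admissible U T"
    using lift spU by (simp add: admissible_iff_adm_rel[OF fin] leU)
  have TU: "finer_top T'' U"
    using lift fin sp spU by (simp add: finer_top_iff_top_le leU)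
  moreover have "admissible T'' U"
    using fin adm TU admissible_finer[OF UT] by (rule admissible_between)
  moreover have "V = quot_top U T''"
    by (rule topology_eq_top_le)
      (use fin spV spU lift in \<open>simp_all add: top_le_quot_top_rel[OF TU] leU\<close>)
  ultimately show "\<exists>U. admissible T'' U \<and> admissible U T \<and> V = quot_top U T''"
    using UT by blast
next
  fix U W
  assume U: "admissible T'' U \<and> admissible U T \<and> V = quot_top U T''"
    and W: "admissible T'' W \<and> admissible W T \<and> V = quot_top W T''"
  have sp: "topspace U = topspace T" "topspace W = topspace T"
    using U W admissible_topspace by blast+
  have "top_le U = top_le W"
  proof (rule adm_rel_unique)
    show "adm_rel (top_le U) (top_le T)" "adm_rel (top_le W) (top_le T)"
      using U W admissible_iff_adm_rel[OF fin] by blast+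
    show "top_le T'' \<le> top_le U" "top_le T'' \<le> top_le W"
      using U W fin sp admissible_finer by (metis finer_top_iff_top_le)+
    show "quot_rel (top_le U) (top_le T'') = quot_rel (top_le W) (top_le T'')"
      using U W admissible_finer top_le_quot_top_rel by metis
  qed
  then show "U = W"
    using fin sp by (intro topology_eq_top_le) simp_all
qed

section \<open>The product\<close>

lemma basis_prod_eq_0: "T2 \<noteq> quot_top T1 T1' \<Longrightarrow> basis_prod (T1, T1') (T2, T2') = 0"
  by (simp add: basis_prod_def)

text \<open>Evaluates the definite description in \<open>basis_prod\<close>: \<open>U\<close> is a
  solution, and the bijection makes it the only one.\<close>

lemma basis_prod_eq_single:
  assumes "finite (topspace T)" and "admissible T' T"
    and "admissible T' U" and "admissible U T"
  shows "basis_prod (T, T') (quot_top T T', quot_top U T') = Poly_Mapping.single (T, U) 1"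
proof -
  have "admissible (quot_top U T') (quot_top T T')"
    using assms by (blast intro: admissible_quot_top admissible_finer)
  then have "(THE W. admissible T' W \<and> admissible W T \<and> quot_top U T' = quot_top W T') = U"
    using assms ex1_admissible_quot_top[of T T' "quot_top U T'"] by (intro the1_equality) auto
  then show ?thesis
    by (simp add: basis_prod_def)
qed

lemma adm_prod_0 [simp]: "0 \<divideontimes> a = 0" "a \<divideontimes> 0 = 0"
  by (simp_all add: adm_prod_def)

lemma adm_prod_assoc_single:
  fixes p q r :: "'a topology \<times> 'a topology"
  assumes "finite X" and "p \<in> adm_pairs X" and "q \<in> adm_pairs X" and "r \<in> adm_pairs X"
  defines "e \<equiv> \<lambda>p. Poly_Mapping.single p (1 :: 'k::field)"
  shows "e p \<divideontimes> e q \<divideontimes> e r = e p \<divideontimes> (e q \<divideontimes> e r)"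
proof -
  obtain T1 T1' T2 T2' T3 T3' where pqr: "p = (T1, T1')" "q = (T2, T2')" "r = (T3, T3')"
    by (cases p, cases q, cases r)
  have fin: "finite (topspace T1)" "finite (topspace T2)"
    and adm: "admissible T1' T1" "admissible T2' T2" "admissible T3' T3"
    using assms by (auto simp: adm_pairs_def pqr)
  have e: "e p \<divideontimes> e q = basis_prod p q" for p q
    by (simp add: e_def adm_prod_single)
  \<comment> \<open>The conditional form allows \<open>e q \<divideontimes> e r\<close> to be
    computed before any case split.\<close>
  obtain W where W: "admissible T2' W" "admissible W T2" "T3' = quot_top W T2'"
    if "T3 = quot_top T2 T2'"
    using ex1_admissible_quot_top[OF fin(2) adm(2), of T3'] adm(3) by blast
  have qr: "e q \<divideontimes> e r = (if T3 = quot_top T2 T2' then e (T2, W) else 0)"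
    unfolding e using basis_prod_eq_single[OF fin(2) adm(2), of W] W
    by (auto simp: pqr basis_prod_eq_0 e_def)
  show ?thesis
  proof (cases "T2 = quot_top T1 T1'")
    case False
    then have "e p \<divideontimes> e q = 0" "e p \<divideontimes> (e q \<divideontimes> e r) = 0"
      unfolding qr by (simp_all add: e pqr basis_prod_eq_0)
    then show ?thesis
      by simp
  next
    case T2: True
    obtain U where U: "admissible T1' U" "admissible U T1" "T2' = quot_top U T1'"
      using ex1_admissible_quot_top[OF fin(1) adm(1), of T2'] adm(2) T2 by blast
    have pq: "e p \<divideontimes> e q = e (T1, U)"
      unfolding e using basis_prod_eq_single[OF fin(1) adm(1) U(1,2)]
      by (simp add: pqr T2 U(3) e_def)
    \<comment> \<open>The left bracketing tests \<open>T3\<close> against \<open>T1/U\<close>, the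
      right one against \<open>T2/T2'\<close>; here the two tests coincide.\<close>
    have T3_iff: "quot_top T2 T2' = quot_top T1 U"
      unfolding T2 U(3) using fin(1) U(1,2) by (intro quot_top_quot_top admissible_finer)
    show ?thesis
    proof (cases "T3 = quot_top T2 T2'")
      case False
      then show ?thesis
        using T3_iff by (simp add: pq qr) (simp add: e pqr basis_prod_eq_0)
    next
      case T3: True
      have "admissible T3' (quot_top T1 U)"
        using adm(3) T3 T3_iff by simp
      \<comment> \<open>\<open>V\<close> is the second component of the left bracketing; the right
        one yields the same \<open>V\<close> once \<open>W = V/T1'\<close> is known.\<close>
      then obtain V where V: "admissible U V" "admissible V T1" "T3' = quot_top V U"
        using ex1_admissible_quot_top[OF fin(1) U(2), of T3'] by blast
      have finV: "finite (topspace V)"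
        using V(2) fin(1) admissible_topspace by metis
      have T1'V: "finer_top T1' V"
        using U(1) V(1) by (blast intro: finer_top_trans admissible_finer)
      then have adm': "admissible T1' V"
        using fin(1) adm(1) V(2) by (blast intro: admissible_between admissible_finer)
      have "e p \<divideontimes> e q \<divideontimes> e r = e (T1, V)"
        unfolding pq unfolding e using basis_prod_eq_single[OF fin(1) U(2) V(1,2)]
        by (simp add: pqr T3 T3_iff V(3) e_def)
      moreover have "W = quot_top V T1'"
      \<comment> \<open>\<open>V/T1'\<close> is shown to satisfy the three conditions that
        characterise \<open>W\<close>.\<close>
      proof -
        have "admissible T2' (quot_top V T1')"
          unfolding U(3) using finV U(1) V(1) by (intro admissible_quot_top admissible_finer)
        moreover have "admissible (quot_top V T1') T2"
          unfolding T2 using fin(1) T1'V V(2) by (rule admissible_quot_top)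
        moreover have "T3' = quot_top (quot_top V T1') T2'"
          unfolding U(3) V(3) using finV U(1) V(1)
          by (intro quot_top_quot_top[symmetric] admissible_finer)
        ultimately show ?thesis
          using ex1_admissible_quot_top[OF fin(2) adm(2), of T3'] adm(3) T3 W[OF T3] by blast
      qed
      then have "e p \<divideontimes> (e q \<divideontimes> e r) = e (T1, V)"
        unfolding qr if_P[OF T3] unfolding e using basis_prod_eq_single[OF fin(1) adm(1) adm' V(2)]
        by (simp add: pqr T2 e_def)
      ultimately show ?thesis
        by simp
    qed
  qed
qed

text \<open>Reduces a property stable under linear combinations to basis elements, one argument of
  the product at a time.\<close>

lemma adm_space_induct [consumes 1, case_names single zero add scale]:
  fixes a :: "('a topology \<times> 'a topology) \<Rightarrow>\<^sub>0 'k::field"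
  assumes "a \<in> adm_space X"
    and single: "\<And>p. p \<in> adm_pairs X \<Longrightarrow> P (Poly_Mapping.single p 1)"
    and zero: "P 0" and add: "\<And>a b. P a \<Longrightarrow> P b \<Longrightarrow> P (a + b)"
    and scale: "\<And>c a. P a \<Longrightarrow> P (vec_scale c a)"
  shows "P a"
proof -
  have "a = (\<Sum>p\<in>Poly_Mapping.keys a.
      vec_scale (Poly_Mapping.lookup a p) (Poly_Mapping.single p 1))"
    by (rule poly_mapping_eqI)
      (auto simp: lookup_sum lookup_single when_def in_keys_iff if_distrib cong: if_cong)
  \<comment> \<open>The index set varies while the coefficients stay those of \<open>a\<close>, so
    that induction on a finite set applies.\<close>
  moreover have "P (\<Sum>p\<in>A. vec_scale (Poly_Mapping.lookup a p) (Poly_Mapping.single p 1))"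
    if "finite A" "A \<subseteq> adm_pairs X" for A
    using that by induction (auto intro: single zero add scale)
  ultimately show ?thesis
    using assms(1) unfolding adm_space_def by (metis (mono_tags) finite_keys mem_Collect_eq)
qed

theorem theorem4p2:
  fixes X :: "'a set"
    and a b c :: "('a topology \<times> 'a topology) \<Rightarrow>\<^sub>0 'k::field"
  assumes "finite X"
    and "a \<in> adm_space X" and "b \<in> adm_space X" and "c \<in> adm_space X"
  shows "(a \<divideontimes> b) \<divideontimes> c = a \<divideontimes> (b \<divideontimes> c)"
proof -
  note bilinear = adm_prod_add_left adm_prod_add_right adm_prod_scale_left adm_prod_scale_right
  let ?e = "\<lambda>p. Poly_Mapping.single p (1 :: 'k)"
  \<comment> \<open>Linearity extends the first factor while the other two are still basis elements;
    then the second follows, and finally the third.\<close>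
  have 1: "a \<divideontimes> ?e q \<divideontimes> ?e r = a \<divideontimes> (?e q \<divideontimes> ?e r)"
    if "q \<in> adm_pairs X" "r \<in> adm_pairs X" for q r
    using assms(2) by (induction rule: adm_space_induct)
      (use assms(1) that in \<open>simp_all add: adm_prod_assoc_single bilinear\<close>)
  have 2: "a \<divideontimes> b \<divideontimes> ?e r = a \<divideontimes> (b \<divideontimes> ?e r)" if "r \<in> adm_pairs X" for r
    using assms(3) by (induction rule: adm_space_induct) (use that in \<open>simp_all add: 1 bilinear\<close>)
  from assms(4) show ?thesis
    by (induction rule: adm_space_induct) (simp_all add: 2 bilinear)
qed

end
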